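(* Let $q$ be a complex number with $0<|q|<1$. If $P:=\dfrac{\varphi (-q)}{q\psi (q^{8})}$ and $Q:=\dfrac{\varphi (-q^2)}{q^2\psi (q^{16})}$, then $$P+\frac{8}{Q}+\frac{2P}{Q}+4=\frac{Q}{P}.$$
   Context: For $|q|<1$, $\varphi(q)=\sum_{m=-\infty}^{\infty}q^{m^2}$ and $\psi(q)=\sum_{m=0}^{\infty}q^{m(m+1)/2}$. *)

theory Defs
  imports "HOL-Analysis.Analysis"
begin

text \<open>
  Ramanujan's theta functions. Both series converge absolutely for \<open>norm q < 1\<close>;
  outside the unit disc the definitions carry no meaning.
\<close>

definition ramanujan_phi :: "complex \<Rightarrow> complex" where
  "ramanujan_phi q = (\<Sum>\<^sub>\<infinity>m::int. q powi (m\<^sup>2))"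

definition ramanujan_psi :: "complex \<Rightarrow> complex" where
  "ramanujan_psi q = (\<Sum>m::nat. q ^ (m * (m + 1) div 2))"

end

theory Submission
  imports Defs
begin

text \<open>
  Put \<open>A = \<phi>(q\<^sup>4)\<close>, \<open>B = 2 q \<psi>(q\<^sup>8)\<close>, \<open>C = \<phi>(q\<^sup>8)\<close> and \<open>D = 2 q\<^sup>2 \<psi>(q\<^sup>1\<^sup>6)\<close>. Splitting \<open>\<phi>\<close> by
  the parity of the summation index gives \<open>\<phi>(\<plusminus>q) = A \<plusminus> B\<close> and \<open>\<phi>(\<plusminus>q\<^sup>2) = C \<plusminus> D\<close>, so that
  \<open>P = 2 (A - B) / B\<close> and \<open>Q = 2 (C - D) / D\<close>. The classical identities
  \<open>\<phi>(q) \<phi>(-q) = \<phi>(-q\<^sup>2)\<^sup>2\<close> and \<open>\<phi>(q)\<^sup>2 + \<phi>(-q)\<^sup>2 = 2 \<phi>(q\<^sup>2)\<^sup>2\<close> become \<open>A\<^sup>2 - B\<^sup>2 = (C - D)\<^sup>2\<close> and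
  \<open>A\<^sup>2 + B\<^sup>2 = (C + D)\<^sup>2\<close>, whence \<open>B\<^sup>2 = 2 C D\<close>, and the claim follows by clearing denominators.
  The denominators do not vanish: a zero of \<open>\<phi>(-x)\<close> or \<open>\<psi>(x\<^sup>8)\<close> propagates to \<open>x\<^sup>2, x\<^sup>4, x\<^sup>8, \<dots>\<close>,
  contradicting the limit \<open>1\<close> at the origin.
\<close>

section \<open>Absolute convergence of the theta series and of their products\<close>

lemma abs_summable_theta:
  fixes x :: complex
  assumes "norm x < 1"
  shows "(\<lambda>m::int. norm (x powi m\<^sup>2)) summable_on UNIV"
proof -
  let ?g = "\<lambda>m::int. norm x ^ nat \<bar>m\<bar>"
  \<comment> \<open>The shift \<open>k = 0\<close> serves the indices \<open>m = n\<close>, and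
    \<open>k = 1\<close> the negative ones \<open>m = - n - 1\<close>, of absolute value
    \<open>n + 1\<close>.\<close>
  have geom: "(\<lambda>n::nat. norm x ^ (n + k)) summable_on UNIV" for k
    using assms by (subst summable_on_UNIV_nonneg_real_iff) (auto simp: summable_iff_shift)
  have "?g summable_on {0..}"
    using geom[of 0] by (subst summable_on_reindex_bij_witness[of _ int nat UNIV]) auto
  moreover have "?g summable_on {..<0}"
    using geom[of 1]
    by (subst summable_on_reindex_bij_witness[of _ "\<lambda>n. - int n - 1" "\<lambda>m. nat (- m - 1)" UNIV
          "\<lambda>n. norm x ^ (n + 1)"]) (auto simp flip: power_Suc simp: Suc_nat_eq_nat_zadd1)
  ultimately have "?g summable_on ({0..} \<union> {..<0})"
    by (rule summable_on_Un_disjoint) auto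
  also have "{0..} \<union> {..<0::int} = UNIV" by auto
  finally have "?g summable_on UNIV" .
  then show ?thesis
  proof (rule Infinite_Sum.abs_summable_on_comparison_test')
    fix m :: int
    have "\<bar>m\<bar> * 1 \<le> \<bar>m\<bar> * \<bar>m\<bar>"
      by (cases "m = 0") (auto intro!: mult_left_mono simp del: mult_1_right abs_mult_self_eq)
    then have "nat \<bar>m\<bar> \<le> nat (m\<^sup>2)"
      by (simp add: power2_eq_square)
    then show "norm (x powi m\<^sup>2) \<le> norm x ^ nat \<bar>m\<bar>"
      using assms by (simp add: power_int_nonneg_exp norm_power power_decreasing)
  qed
qed

lemma has_sum_ramanujan_phi:
  assumes "norm x < 1"
  shows "((\<lambda>m. x powi m\<^sup>2) has_sum ramanujan_phi x) UNIV"
  unfolding ramanujan_phi_def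
  using abs_summable_summable[OF abs_summable_theta[OF assms]] by (rule has_sum_infsum)

lemma has_sum_times:
  fixes f g :: "_ \<Rightarrow> complex"
  assumes "(\<lambda>i. norm (f i)) summable_on A" "(\<lambda>j. norm (g j)) summable_on B"
    and "(f has_sum a) A" "(g has_sum b) B"
  shows "((\<lambda>(i, j). f i * g j) has_sum a * b) (A \<times> B)"
proof -
  have "(\<lambda>p. norm (case p of (i, j) \<Rightarrow> f i * g j)) summable_on A \<times> B"
    unfolding Infinite_Sum.abs_summable_on_Sigma_iff using assms(1,2)
    by (auto simp: norm_mult infsum_cmult_right' abs_mult
        intro!: summable_on_cmult_right summable_on_cmult_left)
  then have s: "(\<lambda>(i, j). f i * g j) summable_on A \<times> B"
    by (rule abs_summable_summable)
  have "infsum (\<lambda>(i, j). f i * g j) (A \<times> B) = a * b"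
    using infsum_Sigma_banach[OF s] assms(3,4)
    by (simp add: infsum_cmult_right' infsum_cmult_left' infsumI)
  then show ?thesis using s by (metis has_sum_infsum)
qed

lemma has_sum_phi_phi:
  assumes "norm x < 1" "norm y < 1"
  shows "((\<lambda>(m, n). x powi m\<^sup>2 * y powi n\<^sup>2) has_sum ramanujan_phi x * ramanujan_phi y) UNIV"
  using has_sum_times[OF abs_summable_theta abs_summable_theta has_sum_ramanujan_phi
      has_sum_ramanujan_phi, OF assms assms] by simp

lemma norm_summable_psi:
  fixes x :: complex
  assumes "norm x < 1"
  shows "summable (\<lambda>m. norm (x ^ (m * (m + 1) div 2)))"
proof (rule summable_comparison_test'[OF summable_geometric])
  show "norm (norm x) < 1" using assms by simp
  fix n :: nat
  have "n * 2 \<le> n * (n + 1)" by (cases n) auto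
  then have "n \<le> n * (n + 1) div 2" by linarith
  then show "norm (norm (x ^ (n * (n + 1) div 2))) \<le> norm x ^ n"
    using assms by (simp add: norm_power power_decreasing)
qed

lemma has_sum_ramanujan_psi:
  assumes "norm x < 1"
  shows "((\<lambda>m. x ^ (m * (m + 1) div 2)) has_sum ramanujan_psi x) UNIV"
  unfolding ramanujan_psi_def
  by (rule norm_summable_imp_has_sum[OF norm_summable_psi summable_sums[OF summable_norm_cancel]])
    (use assms norm_summable_psi in auto)

section \<open>Parity dissections and quadratic theta identities\<close>

lemma has_sum_UNIV_split:
  fixes f :: "_ \<Rightarrow> complex"
  assumes "(f has_sum s) UNIV" "(f has_sum a) A" "(f has_sum b) (- A)"
  shows "s = a + b"
  using has_sum_Un_disjoint[OF assms(2,3)] by (simp add: has_sum_unique[OF assms(1)])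

text \<open>This is where \<psi> enters: odd squares are 1 plus 8 times the triangular numbers in
  its exponents.\<close>

lemma odd_square_eq: "(2 * int n + 1)\<^sup>2 = int (1 + 8 * (n * (n + 1) div 2))"
proof -
  have "2 * (n * (n + 1) div 2) = n * (n + 1)" by simp
  then have "8 * (n * (n + 1) div 2) = 4 * (n * (n + 1))" by linarith
  then show ?thesis by (simp add: power2_eq_square algebra_simps)
qed

text \<open>Indices \<open>2 * k\<close> give the first summand. Indices \<open>2 * n + 1\<close>
  and \<open>- (2 * n + 1)\<close> have equal squares, which accounts for the factor 2.\<close>

lemma phi_split:
  assumes "norm x < 1"
  shows "ramanujan_phi x = ramanujan_phi (x ^ 4) + 2 * x * ramanujan_psi (x ^ 8)"
proof -
  let ?f = "\<lambda>m::int. x powi m\<^sup>2"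
  have x4: "norm (x ^ 4) < 1" and x8: "norm (x ^ 8) < 1"
    using assms by (auto simp: norm_power power_less_one_iff)
  have even: "(?f has_sum ramanujan_phi (x ^ 4)) {m. even m}"
    using has_sum_ramanujan_phi[OF x4]
    by (subst has_sum_reindex_bij_witness[of _ "\<lambda>k. 2 * k" "\<lambda>m. m div 2" UNIV])
      (auto simp: power_int_power power_mult_distrib)
  define T where "T n = x * (x ^ 8) ^ (n * (n + 1) div 2)" for n
  have T: "(T has_sum x * ramanujan_psi (x ^ 8)) UNIV"
    unfolding T_def by (intro has_sum_cmult_right has_sum_ramanujan_psi x8)
  have tm: "T n = x powi (2 * int n + 1)\<^sup>2" for n
    unfolding odd_square_eq power_int_of_nat T_def by (simp add: power_mult)
  have "(?f has_sum x * ramanujan_psi (x ^ 8)) {m. odd m \<and> m \<ge> 0}"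
    using T
    by (subst has_sum_reindex_bij_witness[of _ "\<lambda>n. 2 * int n + 1" "\<lambda>m. nat (m div 2)" UNIV])
      (auto simp: tm)
  moreover have "(?f has_sum x * ramanujan_psi (x ^ 8)) {m. odd m \<and> m < 0}"
    using T
    by (subst has_sum_reindex_bij_witness[of _ "\<lambda>n. - (2 * int n + 1)" "\<lambda>m. nat (- m div 2)" UNIV])
      (auto simp: tm)
  ultimately have "(?f has_sum x * ramanujan_psi (x ^ 8) + x * ramanujan_psi (x ^ 8))
      ({m. odd m \<and> m \<ge> 0} \<union> {m. odd m \<and> m < 0})"
    by (rule has_sum_Un_disjoint) auto
  also have "{m. odd m \<and> m \<ge> 0} \<union> {m. odd m \<and> m < 0} = - {m::int. even m}" by auto
  finally show ?thesis
    using has_sum_UNIV_split[OF has_sum_ramanujan_phi[OF assms] even] by simp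
qed

text \<open>The substitution \<open>m = c + d\<close>, \<open>n = c - d\<close> gives \<open>m\<^sup>2 + n\<^sup>2 = 2 c\<^sup>2 + 2 d\<^sup>2\<close>.\<close>

lemma has_sum_even_pairs:
  assumes "norm x < 1" "y = x \<or> y = - x"
  shows "((\<lambda>(m, n). x powi m\<^sup>2 * y powi n\<^sup>2) has_sum (ramanujan_phi (x * y))\<^sup>2) {(m, n). even (m + n)}"
proof -
  have xy: "norm (x * y) < 1"
    using assms by (auto simp: norm_mult power_less_one_iff simp flip: power2_eq_square)
  have tm: "x powi (c + d)\<^sup>2 * y powi (c - d)\<^sup>2 = (x * y) powi c\<^sup>2 * (x * y) powi d\<^sup>2" for c d :: int
  \<comment> \<open>Base 0 is treated apart: there both sides are 1 if \<open>c = d = 0\<close> and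
    0 otherwise.\<close>
  proof (cases "x = 0")
    case False
    have sq: "(c + d)\<^sup>2 + (c - d)\<^sup>2 = c\<^sup>2 + c\<^sup>2 + d\<^sup>2 + d\<^sup>2"
      by (simp add: power2_eq_square algebra_simps)
    have "x powi (c + d)\<^sup>2 * x powi (c - d)\<^sup>2 = (x * x) powi c\<^sup>2 * (x * x) powi d\<^sup>2"
      using False by (simp add: power_int_mult_distrib sq mult.assoc add.assoc flip: power_int_add del: mult_2)
    \<comment> \<open>For \<open>y = - x\<close> the signs agree because \<open>c - d\<close> and
      \<open>c^2 + d^2\<close> have the same parity.\<close>
    with assms(2) show ?thesis
      by (auto simp: power_int_minus_left)
  next
    case True
    then show ?thesis using assms(2) by (auto simp: power_int_0_left_if)
  qed
  have half: "(m + n) div 2 + (m - n) div 2 = m" "(m + n) div 2 - (m - n) div 2 = n"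
    if "even (m + n)" for m n :: int
    using that by presburger+
  show ?thesis
    using has_sum_phi_phi[OF xy xy]
    by (subst has_sum_reindex_bij_witness[of _ "\<lambda>(c, d). (c + d, c - d)"
          "\<lambda>(m, n). ((m + n) div 2, (m - n) div 2)" UNIV])
      (auto simp: power2_eq_square[of "ramanujan_phi _"] tm[symmetric] half)
qed

text \<open>In the double series for the product, the pairs with even sum already yield the
  right-hand side, so the other pairs must contribute 0.\<close>

lemma phi_mult_phi_minus:
  assumes "norm x < 1"
  shows "ramanujan_phi x * ramanujan_phi (- x) = (ramanujan_phi (- (x\<^sup>2)))\<^sup>2"
proof -
  let ?f = "\<lambda>(m, n). x powi m\<^sup>2 * (- x) powi n\<^sup>2" and ?E = "{(m, n :: int). even (m + n)}"
  have nx: "norm (- x) < 1" using assms by simp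
  have "?f summable_on - ?E"
    using has_sum_imp_summable[OF has_sum_phi_phi[OF assms nx]]
    by (rule summable_on_subset_banach) simp
  then obtain s where s: "(?f has_sum s) (- ?E)" by (auto simp: summable_on_def)
  \<comment> \<open>exchanging \<open>m\<close> and \<open>n\<close> negates the terms with \<open>m + n\<close> odd\<close>
  have "(?f has_sum - s) (- ?E)"
    by (rule has_sum_reindex_bij_witness[of _ "\<lambda>(m, n). (n, m)" "\<lambda>(m, n). (n, m)", THEN iffD1,
          OF _ _ _ _ _ _ has_sum_uminusI[OF s]])
      (auto simp: power_int_minus_left split: if_splits)
  then have "s = 0" using s has_sum_unique by fastforce
  then show ?thesis
    using has_sum_UNIV_split[OF has_sum_phi_phi[OF assms nx] has_sum_even_pairs[OF assms] s]
    by (simp add: power2_eq_square)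
qed

text \<open>When \<open>m + n\<close> is odd, exactly one of the two exponents is odd, so replacing
  \<open>x\<close> by \<open>- x\<close> flips the sign of the term. These pairs cancel in the sum,
  and the even pairs agree.\<close>

lemma phi_square_plus_phi_minus_square:
  assumes "norm x < 1"
  shows "(ramanujan_phi x)\<^sup>2 + (ramanujan_phi (- x))\<^sup>2 = 2 * (ramanujan_phi (x\<^sup>2))\<^sup>2"
proof -
  let ?f = "\<lambda>y (m, n). y powi m\<^sup>2 * y powi n\<^sup>2 :: complex" and ?E = "{(m, n :: int). even (m + n)}"
  have nx: "norm (- x) < 1" using assms by simp
  have "?f x summable_on - ?E"
    using has_sum_imp_summable[OF has_sum_phi_phi[OF assms assms]]
    by (rule summable_on_subset_banach) simp
  then obtain s where s: "(?f x has_sum s) (- ?E)" by (auto simp: summable_on_def)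
  have "(?f (- x) has_sum - s) (- ?E)"
    using has_sum_uminusI[OF s]
    by (rule has_sum_cong[THEN iffD1, rotated])
      (auto simp: power_int_minus_left split: if_splits)
  from has_sum_UNIV_split[OF has_sum_phi_phi[OF nx nx] has_sum_even_pairs[OF nx] this]
    has_sum_UNIV_split[OF has_sum_phi_phi[OF assms assms] has_sum_even_pairs[OF assms] s]
  show ?thesis by (simp add: power2_eq_square)
qed

lemma psi_square:
  assumes "norm x < 1" "x \<noteq> 0"
  shows "(ramanujan_psi (x ^ 8))\<^sup>2 = ramanujan_phi (x ^ 8) * ramanujan_psi (x ^ 16)"
proof -
  have n: "norm (- x) < 1" "norm (x\<^sup>2) < 1" "norm (- (x\<^sup>2)) < 1"
    using assms by (auto simp: norm_power power_less_one_iff)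
  define A B C D where "A = ramanujan_phi (x ^ 4)" "B = 2 * x * ramanujan_psi (x ^ 8)"
    "C = ramanujan_phi (x ^ 8)" "D = 2 * x\<^sup>2 * ramanujan_psi (x ^ 16)"
  note defs = this
  have "ramanujan_phi x = A + B" "ramanujan_phi (- x) = A - B"
    "ramanujan_phi (x\<^sup>2) = C + D" "ramanujan_phi (- (x\<^sup>2)) = C - D"
    using phi_split[OF assms(1)] phi_split[OF n(1)] phi_split[OF n(2)] phi_split[OF n(3)]
    by (simp_all add: defs flip: power_mult)
  then have "(A + B) * (A - B) = (C - D)\<^sup>2" "(A + B)\<^sup>2 + (A - B)\<^sup>2 = 2 * (C + D)\<^sup>2"
    using phi_mult_phi_minus[OF assms(1)] phi_square_plus_phi_minus_square[OF assms(1)] by simp_all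
  \<comment> \<open>Half the second equation minus the first reads
    \<open>2 * B^2 = 4 * C * D\<close>.\<close>
  then have "B\<^sup>2 = 2 * C * D" by algebra
  then have "(4 * x\<^sup>2) * (ramanujan_psi (x ^ 8))\<^sup>2
      = (4 * x\<^sup>2) * (ramanujan_phi (x ^ 8) * ramanujan_psi (x ^ 16))"
    by (simp add: defs power_mult_distrib mult_ac)
  then show ?thesis using assms(2) by (simp only: mult_cancel_left) simp
qed

section \<open>Nonvanishing of the denominators\<close>

lemma nonzero_by_squaring:
  fixes f :: "complex \<Rightarrow> complex"
  assumes "norm x < 1" "x \<noteq> 0"
    and step: "\<And>y. norm y < 1 \<Longrightarrow> y \<noteq> 0 \<Longrightarrow> f y = 0 \<Longrightarrow> f (y\<^sup>2) = 0"
    and lim: "(f \<longlongrightarrow> 1) (at 0)"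
  shows "f x \<noteq> 0"
proof
  assume "f x = 0"
  have zero: "norm (x ^ 2 ^ n) < 1 \<and> x ^ 2 ^ n \<noteq> 0 \<and> f (x ^ 2 ^ n) = 0" for n
  proof (induction n)
    case (Suc n)
    have "x ^ 2 ^ Suc n = (x ^ 2 ^ n)\<^sup>2" by (simp flip: power_mult add: mult.commute)
    with Suc step show ?case
      by (auto simp: norm_power power_less_one_iff)
  qed (use assms \<open>f x = 0\<close> in simp)
  have "(\<lambda>n. x ^ 2 ^ n) \<longlonglongrightarrow> 0"
    using LIMSEQ_subseq_LIMSEQ[OF LIMSEQ_power_zero[OF assms(1)], of "\<lambda>n. 2 ^ n"]
    by (simp add: strict_mono_def o_def)
  \<comment> \<open>The limit of \<open>f\<close> is taken over a punctured neighbourhood, hence the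
    conjunct \<open>x ^ 2 ^ n \<noteq> 0\<close> in \<open>zero\<close>.\<close>
  then have "filterlim (\<lambda>n. x ^ 2 ^ n) (at 0) sequentially"
    using zero by (simp add: filterlim_at)
  from filterlim_compose[OF lim this] have "(\<lambda>_. 0 :: complex) \<longlonglongrightarrow> 1"
    using zero by simp
  then show False by (simp add: LIMSEQ_const_iff)
qed

text \<open>The index \<open>k\<close> contributes the constant term 1. Every other term contains a
  factor \<open>x\<close>, so the remainder is at most a constant times
  \<open>norm x\<close>.\<close>

lemma power_sum_tendsto_1:
  fixes f :: "complex \<Rightarrow> complex" and e :: "'a \<Rightarrow> nat"
  assumes f: "\<And>x. norm x < 1 \<Longrightarrow> ((\<lambda>i. x ^ e i) has_sum f x) UNIV"
    and half: "(\<lambda>i. (1 / 2 :: real) ^ e i) summable_on UNIV"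
    and e: "\<And>i. e i = 0 \<longleftrightarrow> i = k"
  shows "(f \<longlongrightarrow> 1) (at 0)"
proof -
  \<comment> \<open>Pulling one factor \<open>norm x\<close> out of a term leaves exponent
    \<open>e i - 1\<close>; the factor 2 restores \<open>e i\<close> in the bound by powers of
    1/2.\<close>
  define K where "K = (\<Sum>\<^sub>\<infinity>i\<in>- {k}. 2 * (1 / 2 :: real) ^ e i)"
  have K: "((\<lambda>i. norm x * (2 * (1 / 2 :: real) ^ e i)) has_sum norm x * K) (- {k})" for x :: complex
    unfolding K_def using summable_on_subset_banach[OF half, of "- {k}"]
    by (intro has_sum_cmult_right has_sum_infsum summable_on_cmult_right) auto
  have bound: "norm (f x - 1) \<le> norm x * K" if x: "norm x < 1 / 2" for x
  proof (rule norm_infsum_le[OF _ K])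
    have "((\<lambda>i. x ^ e i) has_sum 1) {k}"
      using e[of k] has_sum_finite[of "{k}" "\<lambda>i. x ^ e i"] by simp
    then show "((\<lambda>i. x ^ e i) has_sum (f x - 1)) (- {k})"
      using has_sum_Diff[OF f[of x], of "{k}" 1] x by (simp add: Compl_eq_Diff_UNIV)
    fix i assume "i \<in> - {k}"
    then obtain n where n: "e i = Suc n" using e not0_implies_Suc by blast
    have "norm x ^ n \<le> (1 / 2) ^ n" using x by (intro power_mono) auto
    then show "norm (x ^ e i) \<le> norm x * (2 * (1 / 2) ^ e i)"
      by (simp add: n norm_mult norm_power mult_left_mono)
  qed
  have "((\<lambda>x. f x - 1) \<longlongrightarrow> 0) (at 0)"
  proof (rule Lim_null_comparison)
    show "\<forall>\<^sub>F x in at 0. norm (f x - 1) \<le> norm x * K"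
      using bound by (auto simp: eventually_at intro!: exI[of _ "1 / 2"])
    show "((\<lambda>x::complex. norm x * K) \<longlongrightarrow> 0) (at 0)"
      by (auto intro!: tendsto_eq_intros)
  qed
  then show ?thesis by (simp add: LIM_zero_iff)
qed

lemma phi_tendsto_1: "(ramanujan_phi \<longlongrightarrow> 1) (at 0)"
proof (rule power_sum_tendsto_1)
  show "((\<lambda>m::int. x ^ nat (m\<^sup>2)) has_sum ramanujan_phi x) UNIV" if "norm x < 1" for x
    using has_sum_ramanujan_phi[OF that] by (simp add: power_int_nonneg_exp)
  show "(\<lambda>m::int. (1 / 2 :: real) ^ nat (m\<^sup>2)) summable_on UNIV"
    using abs_summable_theta[of "1 / 2"] by (simp add: power_int_nonneg_exp norm_power norm_divide)
  show "nat (m\<^sup>2) = 0 \<longleftrightarrow> m = 0" for m :: int by simp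
qed

lemma psi_tendsto_1: "(ramanujan_psi \<longlongrightarrow> 1) (at 0)"
proof (rule power_sum_tendsto_1[OF has_sum_ramanujan_psi])
  show "(\<lambda>m. (1 / 2 :: real) ^ (m * (m + 1) div 2)) summable_on UNIV"
    using norm_summable_psi[of "1 / 2"]
    by (subst summable_on_UNIV_nonneg_real_iff) (simp_all add: norm_power norm_divide)
  show "m * (m + 1) div 2 = 0 \<longleftrightarrow> m = 0" for m :: nat
  proof (cases m)
    case (Suc n)
    then have "2 \<le> m * (m + 1)" by simp
    then have "m * (m + 1) div 2 \<noteq> 0" by linarith
    then show ?thesis using Suc by simp
  qed simp
qed

lemma phi_minus_nonzero:
  assumes "norm x < 1" "x \<noteq> 0"
  shows "ramanujan_phi (- x) \<noteq> 0"
proof (rule nonzero_by_squaring[where f = "\<lambda>x. ramanujan_phi (- x)", OF assms])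
  show "ramanujan_phi (- (y\<^sup>2)) = 0" if "norm y < 1" "ramanujan_phi (- y) = 0" for y
    using phi_mult_phi_minus[OF that(1)] that(2) by simp
  have "filterlim (\<lambda>x::complex. - x) (at 0) (at 0)"
    by (auto simp: filterlim_at eventually_at_filter intro!: tendsto_eq_intros)
  then show "((\<lambda>x. ramanujan_phi (- x)) \<longlongrightarrow> 1) (at 0)"
    by (rule filterlim_compose[OF phi_tendsto_1])
qed

text \<open>By \<open>psi_square\<close>, a zero at \<open>y ^ 8\<close> passes to
  \<open>y ^ 16\<close>, since \<phi> does not vanish at \<open>y ^ 8\<close>.\<close>

lemma psi_nonzero:
  assumes "norm x < 1" "x \<noteq> 0"
  shows "ramanujan_psi (x ^ 8) \<noteq> 0"
proof (rule nonzero_by_squaring[where f = "\<lambda>x. ramanujan_psi (x ^ 8)", OF assms])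
  show "ramanujan_psi ((y\<^sup>2) ^ 8) = 0" if y: "norm y < 1" "y \<noteq> 0" "ramanujan_psi (y ^ 8) = 0" for y
  proof -
    have "norm (- (y ^ 8)) < 1" "- (y ^ 8) \<noteq> 0"
      using y by (auto simp: norm_power power_less_one_iff)
    \<comment> \<open>\<open>phi_minus_nonzero\<close> is applied at \<open>- (y ^ 8)\<close>, so
      that the two signs cancel.\<close>
    then have "ramanujan_phi (y ^ 8) \<noteq> 0" using phi_minus_nonzero by fastforce
    then show ?thesis using psi_square[OF y(1,2)] y(3) by (simp flip: power_mult)
  qed
  have "filterlim (\<lambda>x::complex. x ^ 8) (at 0) (at 0)"
    by (auto simp: filterlim_at eventually_at_filter intro!: tendsto_eq_intros)
  then show "((\<lambda>x. ramanujan_psi (x ^ 8)) \<longlongrightarrow> 1) (at 0)"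
    by (rule filterlim_compose[OF psi_tendsto_1])
qed

theorem theorem3p3:
  fixes q P Q :: complex
  assumes "0 < norm q" and "norm q < 1"
    and "P = ramanujan_phi (- q) / (q * ramanujan_psi (q ^ 8))"
    and "Q = ramanujan_phi (- (q ^ 2)) / (q ^ 2 * ramanujan_psi (q ^ 16))"
  shows "P + 8 / Q + 2 * P / Q + 4 = Q / P"
proof -
  have q: "q \<noteq> 0" "norm (- q) < 1" "norm (q\<^sup>2) < 1" "norm (- (q\<^sup>2)) < 1"
    using assms(1,2) by (auto simp: norm_power power_less_one_iff)
  define A B C D where "A = ramanujan_phi (q ^ 4)" "B = 2 * q * ramanujan_psi (q ^ 8)"
    "C = ramanujan_phi (q ^ 8)" "D = 2 * q\<^sup>2 * ramanujan_psi (q ^ 16)"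
  note defs = this
  have AB: "ramanujan_phi q = A + B" "ramanujan_phi (- q) = A - B"
    and CD: "ramanujan_phi (- (q\<^sup>2)) = C - D"
    using phi_split[OF assms(2)] phi_split[OF q(2)] phi_split[OF q(4)]
    by (simp_all add: defs flip: power_mult)
  have diff: "(A + B) * (A - B) = (C - D)\<^sup>2"
    using phi_mult_phi_minus[OF assms(2)] by (simp add: AB CD)
  have B2: "B\<^sup>2 = 2 * C * D"
    using psi_square[OF assms(2) q(1)] by (simp add: defs power_mult_distrib)
  have nz: "A - B \<noteq> 0" "C - D \<noteq> 0" "B \<noteq> 0" "D \<noteq> 0"
    using phi_minus_nonzero[OF assms(2) q(1)] phi_minus_nonzero[OF q(3)] q(1)
      psi_nonzero[OF assms(2) q(1)] psi_nonzero[OF q(3)]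
    unfolding AB CD by (simp_all add: defs flip: power_mult)
  \<comment> \<open>\<open>B\<close> and \<open>D\<close> carry a factor 2 that the denominators of
    \<open>P\<close> and \<open>Q\<close> lack.\<close>
  have "P = (A - B) / (B / 2)" "Q = (C - D) / (D / 2)"
    using assms(3,4) unfolding AB CD by (simp_all add: defs)
  then have P: "P = 2 * (A - B) / B" and Q: "Q = 2 * (C - D) / D"
    by simp_all
  \<comment> \<open>The left-hand side factors, and each factor then becomes a single fraction in
    \<open>A\<close>, \<open>B\<close>, \<open>C\<close>, \<open>D\<close>.\<close>
  have "P + 8 / Q + 2 * P / Q + 4 = (P + 4) * (1 + 2 / Q)"
    by (simp add: algebra_simps add_divide_distrib)
  also have "\<dots> = 2 * (A + B) / B * (C / (C - D))"
  proof -
    have "P + 4 = 2 * (A + B) / B" and "1 + 2 / Q = C / (C - D)"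
      using nz by (simp_all add: P Q field_simps)
    then show ?thesis by simp
  qed
  also have "\<dots> = (C - D) * B / (D * (A - B))"
  proof -
    \<comment> \<open>The cross-multiplied equation is regrouped so that \<open>diff\<close> and
      \<open>B2\<close> each apply once.\<close>
    have "(2 * (A + B) * C) * (D * (A - B)) = ((A + B) * (A - B)) * (2 * C * D)" by algebra
    also have "\<dots> = ((C - D) * B) * (B * (C - D))" unfolding diff B2[symmetric] by algebra
    finally show ?thesis using nz by (simp add: frac_eq_eq)
  qed
  also have "\<dots> = Q / P" using nz by (simp add: P Q field_simps)
  finally show ?thesis .
qed

end
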